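(* Let $S$ be a commutative unital semiring with zero containing an element of infinite multiplicative order, and let $n$ be a positive integer. The stalactic monoid $\mathrm{stal}_n$ of rank $n$ admits a faithful representation by upper triangular matrices of size $n^2$ over $S$ (that is, an injective monoid homomorphism $\mathrm{stal}_n\to\mathrm{UT}_{n^2}(S)$) having block-diagonal structure with largest block of size $2$ (or size $1$ if $n=1$).
   Context: $[n]=\{1,\dots,n\}$, and $[n]^*$ is the free monoid on $[n]$. $\mathrm{UT}_m(S)$ is the monoid of $m\times m$ upper triangular matrices over the semiring $S$ (entries below the diagonal equal to $0_S$) under matrix multiplication. A stalactic tableau is a finite array of positive integers in which columns are top-aligned and two symbols appear in the same column if and only if they are equal. Insertion of a symbol $a$ into a stalactic tableau $T$: if $a$ does not appear in $T$, add $a$ to the left of the top row of $T$ (as a new leftmost column); if $a$ appears in $T$, add $a$ to the bottom of the unique column containing $a$. For a word $u$ over the positive integers, $\mathrm{P}_{\mathrm{stal}}(u)$ is the tableau obtained from the empty tableau by inserting the symbols of $u$ from right to left. The relation $u\equiv_{\mathrm{stal}}v\iff \mathrm{P}_{\mathrm{stal}}(u)=\mathrm{P}_{\mathrm{stal}}(v)$ is a congruence, and $\mathrm{stal}_n=[n]^*/{\equiv_{\mathrm{stal}}}$. *)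

theory Defs
  imports
    "HOL-Algebra.Group"
    "Jordan_Normal_Form.Matrix"
begin

section \<open>Stalactic tableaux\<close>

text \<open>
  A top-aligned array is the list of its columns, from left to right, each column being the
  nonempty list of its entries, from top to bottom.
\<close>

type_synonym tableau = "nat list list"

definition stalactic_tableau :: "tableau \<Rightarrow> bool" where
  "stalactic_tableau T \<longleftrightarrow>
     (\<forall>c\<in>set T. c \<noteq> [] \<and> (\<forall>a\<in>set c. 0 < a)) \<and>
     (\<forall>i<length T. \<forall>j<length T. \<forall>a\<in>set (T ! i). \<forall>b\<in>set (T ! j). i = j \<longleftrightarrow> a = b)"

definition symbols :: "tableau \<Rightarrow> nat set" where
  "symbols T = (\<Union>c\<in>set T. set c)"

definition stal_insert :: "nat \<Rightarrow> tableau \<Rightarrow> tableau" where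
  "stal_insert a T =
     (if a \<in> symbols T then map (\<lambda>c. if a \<in> set c then c @ [a] else c) T else [a] # T)"

text \<open>\<^const>\<open>foldr\<close> processes the word from right to left.\<close>

definition P_stal :: "nat list \<Rightarrow> tableau" where
  "P_stal u = foldr stal_insert u []"


section \<open>The stalactic monoid of rank n\<close>

definition stal_rel :: "nat \<Rightarrow> (nat list \<times> nat list) set" where
  "stal_rel n = {(u, v). u \<in> lists {1..n} \<and> v \<in> lists {1..n} \<and> P_stal u = P_stal v}"

definition stal :: "nat \<Rightarrow> nat list set monoid" where
  "stal n = \<lparr>
     carrier = lists {1..n} // stal_rel n,
     mult = (\<lambda>X Y. \<Union>u\<in>X. \<Union>v\<in>Y. stal_rel n `` {u @ v}),
     one = stal_rel n `` {[]}\<rparr>"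


section \<open>Upper triangular matrices and block structure\<close>

definition UT :: "'a::comm_semiring_1 itself \<Rightarrow> nat \<Rightarrow> 'a mat monoid" where
  "UT S m = \<lparr>
     carrier = {A \<in> carrier_mat m m. upper_triangular A},
     mult = (*),
     one = 1\<^sub>m m\<rparr>"

definition infinite_mult_order :: "'a::monoid_mult \<Rightarrow> bool" where
  "infinite_mult_order x \<longleftrightarrow> inj (\<lambda>k::nat. x ^ k)"

text \<open>
  The list \<open>bs\<close> prescribes the sizes of the diagonal blocks, so that one \<open>bs\<close> can be imposed on
  a whole family of matrices.
\<close>

definition block_diagonal :: "nat list \<Rightarrow> 'a::zero mat \<Rightarrow> bool" where
  "block_diagonal bs A \<longleftrightarrow>
     (\<exists>Bs. list_all2 (\<lambda>b B. B \<in> carrier_mat b b) bs Bs \<and> A = diag_block_mat Bs)"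


section \<open>Well-definedness\<close>

lemma P_stal_eq: "P_stal u = map (\<lambda>a. replicate (count_list u a) a) (remdups u)"
proof (induction u)
  case Nil
  show ?case by (simp add: P_stal_def)
next
  case (Cons a u)
  have sym: "symbols (P_stal u) = set u"
    unfolding Cons.IH symbols_def by (auto simp: set_replicate_conv_if count_list_0_iff)
  have "P_stal (a # u) = stal_insert a (P_stal u)"
    by (simp add: P_stal_def)
  also have "\<dots> = map (\<lambda>b. replicate (count_list (a # u) b) b) (remdups (a # u))"
  proof (cases "a \<in> set u")
    case True
    then show ?thesis
      unfolding stal_insert_def sym unfolding Cons.IH
      by (auto simp: set_replicate_conv_if count_list_0_iff replicate_append_same)
  next
    case False
    then show ?thesis
      unfolding stal_insert_def sym unfolding Cons.IH
      by (auto simp: count_list_0_iff[THEN iffD2])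
  qed
  finally show ?case .
qed

lemma stalactic_tableau_P_stal:
  assumes "0 \<notin> set u"
  shows "stalactic_tableau (P_stal u)"
proof -
  have "a \<noteq> 0" if "a \<in> set u" for a using that assms by metis
  then show ?thesis
    unfolding stalactic_tableau_def P_stal_eq
    by (auto simp: count_list_0_iff nth_eq_iff_index_eq dest: gr0I)
qed

lemma P_stal_eq_iff:
  "P_stal u = P_stal v \<longleftrightarrow> remdups u = remdups v \<and> count_list u = count_list v"
proof
  assume eq: "P_stal u = P_stal v"
  have hd: "map hd (P_stal w) = remdups w" for w
  proof -
    have "hd (replicate (count_list w a) a) = a" if "a \<in> set w" for a
      using that count_list_0_iff[of w a] by simp
    then show ?thesis unfolding P_stal_eq by (auto simp: o_def intro!: map_idI)
  qed
  have r: "remdups u = remdups v" using eq hd by metis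
  then have s: "set u = set v" by (metis set_remdups)
  have "count_list u a = count_list v a" for a
  proof (cases "a \<in> set u")
    case True
    then have "replicate (count_list u a) a = replicate (count_list v a) a"
      using eq unfolding P_stal_eq r using s by simp
    then show ?thesis by (metis length_replicate)
  next
    case False
    then show ?thesis using s by (metis count_list_0_iff)
  qed
  then show "remdups u = remdups v \<and> count_list u = count_list v" using r by auto
qed (simp add: P_stal_eq)

lemma P_stal_append_cong:
  assumes "P_stal u = P_stal u'" "P_stal v = P_stal v'"
  shows "P_stal (u @ v) = P_stal (u' @ v')"
proof -
  have rd: "remdups (x @ y) = filter (\<lambda>a. a \<notin> set y) (remdups x) @ remdups y" for x y :: "nat list"
    by (induction x) auto
  have "set v = set v'" using assms(2) unfolding P_stal_eq_iff by (metis set_remdups)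
  then show ?thesis using assms unfolding P_stal_eq_iff by (auto simp: rd fun_eq_iff)
qed

lemma equiv_stal_rel: "equiv (lists {1..n}) (stal_rel n)"
  by (rule equivI) (auto simp: stal_rel_def refl_on_def sym_def trans_def)

lemma stal_mult_class:
  assumes "u \<in> lists {1..n}" "v \<in> lists {1..n}"
  shows "stal_rel n `` {u} \<otimes>\<^bsub>stal n\<^esub> stal_rel n `` {v} = stal_rel n `` {u @ v}"
proof -
  have "congruent2 (stal_rel n) (stal_rel n) (\<lambda>x y. stal_rel n `` {x @ y})"
  proof (rule congruent2I')
    fix x x' y y'
    assume "(x, x') \<in> stal_rel n" "(y, y') \<in> stal_rel n"
    then have "(x @ y, x' @ y') \<in> stal_rel n"
      by (auto simp: stal_rel_def intro: P_stal_append_cong)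
    then show "stal_rel n `` {x @ y} = stal_rel n `` {x' @ y'}"
      by (rule equiv_class_eq[OF equiv_stal_rel])
  qed
  then show ?thesis
    using UN_equiv_class2[OF equiv_stal_rel equiv_stal_rel _ assms] by (simp add: stal_def)
qed

lemma monoid_stal: "monoid (stal n)"
proof -
  have carr: "X \<in> carrier (stal n) \<longleftrightarrow> (\<exists>u\<in>lists {1..n}. X = stal_rel n `` {u})" for X
    by (auto simp: stal_def quotient_def)
  have one: "\<one>\<^bsub>stal n\<^esub> = stal_rel n `` {[]}"
    by (simp add: stal_def)
  have app: "u @ v \<in> lists {1..n}" if "u \<in> lists {1..n}" "v \<in> lists {1..n}" for u v :: "nat list"
    using that by auto
  show ?thesis
  proof
    fix X Y assume "X \<in> carrier (stal n)" "Y \<in> carrier (stal n)"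
    then show "X \<otimes>\<^bsub>stal n\<^esub> Y \<in> carrier (stal n)"
      unfolding carr using stal_mult_class app by blast
  next
    fix X Y Z
    assume "X \<in> carrier (stal n)" "Y \<in> carrier (stal n)" "Z \<in> carrier (stal n)"
    then obtain u v w where
      "u \<in> lists {1..n}" "v \<in> lists {1..n}" "w \<in> lists {1..n}"
      "X = stal_rel n `` {u}" "Y = stal_rel n `` {v}" "Z = stal_rel n `` {w}"
      unfolding carr by blast
    then show "X \<otimes>\<^bsub>stal n\<^esub> Y \<otimes>\<^bsub>stal n\<^esub> Z = X \<otimes>\<^bsub>stal n\<^esub> (Y \<otimes>\<^bsub>stal n\<^esub> Z)"
      by (simp only: stal_mult_class app append_assoc)
  next
    show "\<one>\<^bsub>stal n\<^esub> \<in> carrier (stal n)"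
      unfolding carr one by blast
  next
    fix X assume "X \<in> carrier (stal n)"
    then obtain u where u: "u \<in> lists {1..n}" "X = stal_rel n `` {u}"
      unfolding carr by blast
    have nil: "[] \<in> lists {1..n}" by simp
    show "\<one>\<^bsub>stal n\<^esub> \<otimes>\<^bsub>stal n\<^esub> X = X" "X \<otimes>\<^bsub>stal n\<^esub> \<one>\<^bsub>stal n\<^esub> = X"
      unfolding u(2) one by (simp_all only: stal_mult_class[OF nil u(1)] stal_mult_class[OF u(1) nil]
          append_Nil append_Nil2)
  qed
qed

lemma monoid_UT: "monoid (UT TYPE('a::comm_semiring_1) m)"
proof -
  have "upper_triangular (A * B)"
    if A: "A \<in> carrier_mat m m" "upper_triangular A" and B: "B \<in> carrier_mat m m" "upper_triangular B"
    for A B :: "'a mat"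
  proof
    fix i j assume ij: "j < i" "i < dim_row (A * B)"
    have "A $$ (i, k) * B $$ (k, j) = 0" if "k < m" for k
      using that ij A B upper_triangularD[OF A(2), of k i] upper_triangularD[OF B(2), of j k]
      by (cases "k < i") auto
    then show "(A * B) $$ (i, j) = 0"
      using ij A B by (auto simp: scalar_prod_def intro!: sum.neutral)
  qed
  then show ?thesis
    by unfold_locales (auto simp: UT_def assoc_mult_mat[of _ m m _ m _ m])
qed

end

theory Submission
  imports Defs
begin

text \<open>
  A stalactic class is determined by two kinds of data about a representing word \<open>u\<close>: how often
  each symbol occurs, and in which order the symbols occur for the last time, i.e. the list
  \<open>remdups u\<close>, which keeps the last occurrence of each symbol (\<open>P_stal_eq_iff\<close>). The order is in turn determined by its restrictions
  to pairs: it is enough to know, for all \<open>a < b\<close>, which of \<open>a\<close> and \<open>b\<close> occurs last in \<open>u\<close>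
  (\<open>distinct_eqI_last_pair\<close>).

  Both kinds of data are multiplicative and are seen by small triangular matrices. The number of
  occurrences of \<open>a\<close> is recorded by the \<open>1 \<times> 1\<close> matrix \<open>x ^ count_list u a\<close>, which loses nothing
  as \<open>x\<close> has infinite order. For the last occurrence, consider the matrices with first row
  \<open>(1, s)\<close> and second row \<open>(0, 0)\<close>: the product of two of them is the second factor, so
  they form a right zero band, and a product of such matrices remembers exactly its last factor.
  Sending \<open>a\<close> to the one with \<open>s = 0\<close>, \<open>b\<close> to the one with \<open>s = 1\<close> and all other symbols to the
  identity gives a \<open>2 \<times> 2\<close> representation that records which of \<open>a\<close> and \<open>b\<close> comes last.

  The direct sum of these representations over all \<open>a \<le> b\<close>, with \<open>a = b\<close> standing for the
  count of \<open>a\<close>, is faithful, and its size is \<open>n + 2 * (n choose 2) = n\<^sup>2\<close>.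
\<close>

section \<open>Block diagonal matrices with a common block pattern\<close>

lemma diag_block_mat_map_carrier:
  assumes "\<And>i. i \<in> set is \<Longrightarrow> F i \<in> carrier_mat (d i) (d i)"
  shows "diag_block_mat (map F is) \<in> carrier_mat (sum_list (map d is)) (sum_list (map d is))"
proof -
  have "map dim_row (map F is) = map d is" "map dim_col (map F is) = map d is"
    using assms carrier_matD by fastforce+
  then show ?thesis by (intro carrier_matI) (simp_all only: dim_diag_block_mat)
qed

lemma diag_block_mat_map_Cons:
  assumes "\<And>j. j \<in> set (i # is) \<Longrightarrow> F j \<in> carrier_mat (d j) (d j)"
  shows "diag_block_mat (map F (i # is)) =
    four_block_mat (F i) (0\<^sub>m (d i) (sum_list (map d is))) (0\<^sub>m (sum_list (map d is)) (d i))
      (diag_block_mat (map F is))"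
proof -
  have "F i \<in> carrier_mat (d i) (d i)" using assms by simp
  moreover have
    "diag_block_mat (map F is) \<in> carrier_mat (sum_list (map d is)) (sum_list (map d is))"
    using assms by (intro diag_block_mat_map_carrier) simp
  ultimately show ?thesis
    by (simp only: list.map diag_block_mat.simps Let_def carrier_matD)
qed

lemma diag_block_mat_map_mult:
  fixes F G :: "'i \<Rightarrow> 'a::semiring_0 mat"
  assumes "\<And>i. i \<in> set is \<Longrightarrow> F i \<in> carrier_mat (d i) (d i)"
    and "\<And>i. i \<in> set is \<Longrightarrow> G i \<in> carrier_mat (d i) (d i)"
  shows "diag_block_mat (map F is) * diag_block_mat (map G is) =
    diag_block_mat (map (\<lambda>i. F i * G i) is)"
  using assms
proof (induction "is")
  case Nil
  show ?case by auto
next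
  case (Cons i "is")
  let ?m = "sum_list (map d is)"
  have F: "F i \<in> carrier_mat (d i) (d i)" "diag_block_mat (map F is) \<in> carrier_mat ?m ?m"
    and G: "G i \<in> carrier_mat (d i) (d i)" "diag_block_mat (map G is) \<in> carrier_mat ?m ?m"
    using Cons.prems(1,2) by (simp_all add: diag_block_mat_map_carrier[where d = d])
  have IH: "diag_block_mat (map F is) * diag_block_mat (map G is) =
      diag_block_mat (map (\<lambda>i. F i * G i) is)"
    using Cons.IH Cons.prems by simp
  have FG: "F j * G j \<in> carrier_mat (d j) (d j)" if "j \<in> set (i # is)" for j
    using Cons.prems(1,2)[OF that] by (rule mult_carrier_mat)
  have "diag_block_mat (map F (i # is)) * diag_block_mat (map G (i # is)) =
      four_block_mat (F i * G i) (0\<^sub>m (d i) ?m) (0\<^sub>m ?m (d i))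
        (diag_block_mat (map F is) * diag_block_mat (map G is))"
    using F G
    by (simp only: diag_block_mat_map_Cons[where d = d] Cons.prems(1,2),
        subst mult_four_block_mat[where ?nr1.0 = "d i" and ?n1.0 = "d i" and ?nc1.0 = "d i"
          and ?nr2.0 = ?m and ?n2.0 = ?m and ?nc2.0 = ?m]) auto
  also have "\<dots> = diag_block_mat (map (\<lambda>i. F i * G i) (i # is))"
    by (simp only: diag_block_mat_map_Cons[where d = d] FG IH)
  finally show ?case .
qed

lemma diag_block_mat_map_inj:
  assumes "\<And>i. i \<in> set is \<Longrightarrow> F i \<in> carrier_mat (d i) (d i)"
    and "\<And>i. i \<in> set is \<Longrightarrow> G i \<in> carrier_mat (d i) (d i)"
    and "diag_block_mat (map F is) = diag_block_mat (map G is)"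
    and "i \<in> set is"
  shows "F i = G i"
  using assms
proof (induction "is")
  case (Cons j "is")
  let ?m = "sum_list (map d is)"
  let ?M = "\<lambda>F. four_block_mat (F j) (0\<^sub>m (d j) ?m) (0\<^sub>m ?m (d j)) (diag_block_mat (map F is))"
  have F: "F j \<in> carrier_mat (d j) (d j)" "diag_block_mat (map F is) \<in> carrier_mat ?m ?m"
    and G: "G j \<in> carrier_mat (d j) (d j)" "diag_block_mat (map G is) \<in> carrier_mat ?m ?m"
    using Cons.prems(1,2) by (simp_all add: diag_block_mat_map_carrier[where d = d])
  have eq: "?M F = ?M G"
    using Cons.prems(3)
    by (simp only: diag_block_mat_map_Cons[where d = d] Cons.prems(1,2))
  have "F j = G j"
  proof (rule eq_matI)
    fix k l assume "k < dim_row (G j)" "l < dim_col (G j)"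
    then show "F j $$ (k, l) = G j $$ (k, l)"
      using arg_cong[OF eq, of "\<lambda>A. A $$ (k, l)"] F G by auto
  qed (use F G in auto)
  moreover have "diag_block_mat (map F is) = diag_block_mat (map G is)"
  proof (rule eq_matI)
    fix k l
    assume "k < dim_row (diag_block_mat (map G is))" "l < dim_col (diag_block_mat (map G is))"
    then show "diag_block_mat (map F is) $$ (k, l) = diag_block_mat (map G is) $$ (k, l)"
      using arg_cong[OF eq, of "\<lambda>A. A $$ (k + d j, l + d j)"] F G by auto
  qed (use F G in auto)
  ultimately show ?case using Cons by auto
qed simp

lemma diag_block_mat_map_one:
  "diag_block_mat (map (\<lambda>i. 1\<^sub>m (d i)) is) = 1\<^sub>m (sum_list (map d is))"
  using diag_block_one_mat[of "map (\<lambda>i. 1\<^sub>m (d i)) is"] by (simp add: o_def)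

lemma diag_block_mat_map_upper_triangular:
  assumes "\<And>i. i \<in> set is \<Longrightarrow> F i \<in> carrier_mat (d i) (d i)"
    and "\<And>i. i \<in> set is \<Longrightarrow> upper_triangular (F i)"
  shows "upper_triangular (diag_block_mat (map F is))"
proof
  fix k l assume "l < k" "k < dim_row (diag_block_mat (map F is))"
  then show "diag_block_mat (map F is) $$ (k, l) = 0"
    by (intro diag_block_upper_triangular) (use assms in fastforce)+
qed


section \<open>The order of last occurrences is determined by pairs of symbols\<close>

text \<open>
  In a distinct list, the head is never the last one of a pair. If two lists had different heads
  \<open>a\<close> and \<open>b\<close>, then \<open>b\<close> would be last of the two in the first list, and \<open>a\<close> in the second. So the
  heads agree, and the tails inherit the hypothesis.
\<close>

lemma distinct_eqI_last_pair:
  assumes "distinct xs" "distinct ys" "set xs = set ys"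
    and "\<And>a b. a \<in> set xs \<Longrightarrow> b \<in> set xs \<Longrightarrow> a \<noteq> b \<Longrightarrow>
      last (filter (\<lambda>c. c = a \<or> c = b) xs) = last (filter (\<lambda>c. c = a \<or> c = b) ys)"
  shows "xs = ys"
  using assms
proof (induction xs arbitrary: ys)
  case (Cons a xs)
  obtain b ys' where ys: "ys = b # ys'"
    using Cons.prems(3) by (cases ys) auto
  have last_hd: "last (filter (\<lambda>c. c = a \<or> c = b) (a # zs)) = b"
    if "b \<in> set zs" "a \<notin> set zs" for a b :: 'a and zs
  proof -
    have "last (filter (\<lambda>c. c = a \<or> c = b) zs) \<in> set (filter (\<lambda>c. c = a \<or> c = b) zs)"
      using that by (intro last_in_set) (auto simp: filter_empty_conv)
    then show ?thesis using that by (auto simp: filter_empty_conv)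
  qed
  have "a = b"
  proof (rule ccontr)
    assume ne: "a \<noteq> b"
    then have "b \<in> set xs" "a \<in> set ys'"
      using Cons.prems(3) ys by auto
    then have "last (filter (\<lambda>c. c = a \<or> c = b) (a # xs)) = b"
      and "last (filter (\<lambda>c. c = b \<or> c = a) (b # ys')) = a"
      using Cons.prems(1,2) ys last_hd[of b xs a] last_hd[of a ys' b] by simp_all
    then show False
      using Cons.prems(4)[of a b] ne \<open>b \<in> set xs\<close> ys by (auto simp: disj_commute)
  qed
  moreover have "xs = ys'"
  proof (rule Cons.IH)
    show s: "set xs = set ys'"
      using Cons.prems(1-3) ys \<open>a = b\<close> by auto
    show "last (filter (\<lambda>e. e = c \<or> e = d) xs) = last (filter (\<lambda>e. e = c \<or> e = d) ys')"
      if "c \<in> set xs" "d \<in> set xs" "c \<noteq> d" for c d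
    proof -
      have "filter (\<lambda>e. e = c \<or> e = d) (a # xs) = filter (\<lambda>e. e = c \<or> e = d) xs"
        "filter (\<lambda>e. e = c \<or> e = d) ys = filter (\<lambda>e. e = c \<or> e = d) ys'"
        using that Cons.prems(1) ys \<open>a = b\<close> by auto
      then show ?thesis
        using Cons.prems(4)[of c d] that by simp
    qed
  qed (use Cons.prems ys in auto)
  ultimately show ?case using ys by simp
qed simp


section \<open>The blocks\<close>

definition right_zero_mat :: "'a::semiring_1 \<Rightarrow> 'a mat" where
  "right_zero_mat s = mat 2 2 (\<lambda>(i, j). if i = 0 then if j = 0 then 1 else s else 0)"

lemma right_zero_mat_carrier [simp]: "right_zero_mat s \<in> carrier_mat 2 2"
  by (simp add: right_zero_mat_def)

lemma right_zero_mat_mult: "right_zero_mat s * right_zero_mat t = right_zero_mat t"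
  by (rule eq_matI) (auto simp: right_zero_mat_def scalar_prod_def numeral_2_eq_2)

lemma right_zero_mat_inj: "right_zero_mat s = right_zero_mat t \<longleftrightarrow> s = t"
proof
  assume "right_zero_mat s = right_zero_mat t"
  then have "right_zero_mat s $$ (0, 1) = right_zero_mat t $$ (0, 1)" by simp
  then show "s = t" by (simp add: right_zero_mat_def)
qed simp

lemma right_zero_mat_neq_one: "right_zero_mat (s :: 'a::semiring_1) \<noteq> 1\<^sub>m 2"
proof
  assume "right_zero_mat s = 1\<^sub>m 2"
  then have "right_zero_mat s $$ (1, 1) = (1\<^sub>m 2 :: 'a mat) $$ (1, 1)" by simp
  then show False by (simp add: right_zero_mat_def)
qed

text \<open>The value is the image of \<open>u\<close> under the homomorphism described at the top.\<close>

definition last_pair_mat :: "'b \<Rightarrow> 'b \<Rightarrow> 'b list \<Rightarrow> 'a::semiring_1 mat" where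
  "last_pair_mat a b u =
     (let w = filter (\<lambda>c. c = a \<or> c = b) u
      in if w = [] then 1\<^sub>m 2 else right_zero_mat (if last w = a then 0 else 1))"

lemma last_pair_mat_carrier [simp]: "last_pair_mat a b u \<in> carrier_mat 2 2"
  by (simp add: last_pair_mat_def Let_def)

lemma last_pair_mat_append: "last_pair_mat a b (u @ v) = last_pair_mat a b u * last_pair_mat a b v"
proof -
  have "right_zero_mat s * 1\<^sub>m 2 = right_zero_mat s" "1\<^sub>m 2 * right_zero_mat s = right_zero_mat s"
    for s :: 'a
    by (simp_all only: right_mult_one_mat[OF right_zero_mat_carrier]
        left_mult_one_mat[OF right_zero_mat_carrier])
  then show ?thesis
    by (simp add: last_pair_mat_def Let_def right_zero_mat_mult)
qed

lemma last_pair_mat_upper_triangular: "upper_triangular (last_pair_mat a b u)"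
  by (auto simp: last_pair_mat_def Let_def right_zero_mat_def)

lemma last_pair_mat_remdups: "last_pair_mat a b (remdups u) = last_pair_mat a b u"
  by (simp add: last_pair_mat_def Let_def remdups_filter_last filter_empty_conv)

lemma last_pair_mat_eqD:
  assumes eq: "last_pair_mat a b u = (last_pair_mat a b v :: 'a::semiring_1 mat)"
    and "a \<in> set u"
  shows "last (filter (\<lambda>c. c = a \<or> c = b) u) = last (filter (\<lambda>c. c = a \<or> c = b) v)"
proof -
  let ?u = "filter (\<lambda>c. c = a \<or> c = b) u" and ?v = "filter (\<lambda>c. c = a \<or> c = b) v"
  have u: "?u \<noteq> []" using assms(2) by (auto simp: filter_empty_conv)
  have v: "?v \<noteq> []"
    using eq u right_zero_mat_neq_one[where ?'a = 'a]
    by (auto simp: last_pair_mat_def Let_def split: if_splits)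
  have "last ?u \<in> {a, b}" "last ?v \<in> {a, b}"
    using last_in_set[OF u] last_in_set[OF v] by auto
  moreover have "last ?u = a \<longleftrightarrow> last ?v = a"
    using eq u v
    by (simp add: last_pair_mat_def Let_def right_zero_mat_inj split: if_splits)
  ultimately show ?thesis by auto
qed


section \<open>The representation\<close>

text \<open>
  A pair \<open>(a, a)\<close> stands for the count of \<open>a\<close>, a pair \<open>(a, b)\<close> with \<open>a < b\<close> for the question
  which of the two occurs last.
\<close>

definition block_index :: "nat \<Rightarrow> (nat \<times> nat) list" where
  "block_index n = concat (map (\<lambda>b. map (\<lambda>a. (a, b)) [1..<Suc b]) [1..<Suc n])"

definition block_size :: "nat \<times> nat \<Rightarrow> nat" where
  "block_size = (\<lambda>(a, b). if a = b then 1 else 2)"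

definition stal_block :: "'a::comm_semiring_1 \<Rightarrow> nat list \<Rightarrow> nat \<times> nat \<Rightarrow> 'a mat" where
  "stal_block x u =
     (\<lambda>(a, b). if a = b then mat 1 1 (\<lambda>_. x ^ count_list u a) else last_pair_mat a b u)"

definition word_rep :: "'a::comm_semiring_1 \<Rightarrow> nat \<Rightarrow> nat list \<Rightarrow> 'a mat" where
  "word_rep x n u = diag_block_mat (map (stal_block x u) (block_index n))"

lemma set_block_index: "set (block_index n) = {(a, b). 1 \<le> a \<and> a \<le> b \<and> b \<le> n}"
  by (auto simp: block_index_def image_iff simp del: upt_Suc)

text \<open>The blocks with second index \<open>b\<close> have total size \<open>2 * b - 1\<close>, the \<open>b\<close>-th odd number.\<close>

lemma sum_block_size: "sum_list (map block_size (block_index n)) = n\<^sup>2"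
proof (induction n)
  case 0
  show ?case by (simp add: block_index_def)
next
  case (Suc n)
  have "map block_size (map (\<lambda>a. (a, Suc n)) [1..<Suc (Suc n)]) = map (\<lambda>_. 2) [1..<Suc n] @ [1]"
    by (subst upt_Suc_append) (auto simp: block_size_def simp del: upt_Suc)
  then have "sum_list (map block_size (map (\<lambda>a. (a, Suc n)) [1..<Suc (Suc n)])) = 2 * n + 1"
    by (simp only: sum_list_append sum_list_triv) simp
  moreover have "block_index (Suc n) =
      block_index n @ map (\<lambda>a. (a, Suc n)) [1..<Suc (Suc n)]"
    by (simp add: block_index_def)
  ultimately show ?case
    using Suc by (simp add: power2_eq_square del: upt_Suc map_map)
qed

lemma stal_block_carrier: "stal_block x u i \<in> carrier_mat (block_size i) (block_size i)"
  by (auto simp: stal_block_def block_size_def split: prod.split)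

lemma stal_block_append: "stal_block x (u @ v) i = stal_block x u i * stal_block x v i"
proof -
  have "mat 1 1 (\<lambda>_. s * t) = mat 1 1 (\<lambda>_. s) * mat 1 1 (\<lambda>_. t)" for s t :: 'a
    by (rule eq_matI) (auto simp: scalar_prod_def)
  then show ?thesis
    by (auto simp: stal_block_def last_pair_mat_append power_add split: prod.split)
qed

lemma stal_block_Nil: "stal_block x [] i = 1\<^sub>m (block_size i)"
proof -
  have "mat 1 1 (\<lambda>_. 1 :: 'a) = 1\<^sub>m 1"
    by (rule eq_matI) auto
  then show ?thesis
    by (auto simp: stal_block_def block_size_def last_pair_mat_def split: prod.split)
qed

lemma word_rep_in_UT: "word_rep x n u \<in> carrier (UT TYPE('a::comm_semiring_1) (n\<^sup>2))"
proof -
  have "word_rep x n u \<in> carrier_mat (n\<^sup>2) (n\<^sup>2)"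
    using diag_block_mat_map_carrier[of "block_index n" "stal_block x u" block_size]
    by (simp add: word_rep_def stal_block_carrier sum_block_size)
  moreover have "upper_triangular (stal_block x u i)" for i
    by (cases i) (auto simp: stal_block_def last_pair_mat_upper_triangular)
  then have "upper_triangular (word_rep x n u)"
    unfolding word_rep_def
    by (intro diag_block_mat_map_upper_triangular[where d = block_size] stal_block_carrier)
  ultimately show ?thesis by (simp add: UT_def)
qed

lemma word_rep_append: "word_rep x n (u @ v) = word_rep x n u * word_rep x n v"
proof -
  have "word_rep x n u * word_rep x n v =
      diag_block_mat (map (\<lambda>i. stal_block x u i * stal_block x v i) (block_index n))"
    unfolding word_rep_def
    by (rule diag_block_mat_map_mult[where d = block_size]) (rule stal_block_carrier)+
  then show ?thesis
    by (simp add: word_rep_def stal_block_append[abs_def])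
qed

lemma word_rep_Nil: "word_rep x n [] = 1\<^sub>m (n\<^sup>2)"
  by (simp add: word_rep_def stal_block_Nil[abs_def] diag_block_mat_map_one sum_block_size)

lemma block_diagonal_word_rep: "block_diagonal (map block_size (block_index n)) (word_rep x n u)"
  unfolding block_diagonal_def word_rep_def
  by (rule exI[of _ "map (stal_block x u) (block_index n)"])
    (simp add: list_all2_map1 list_all2_map2 list_all2_same stal_block_carrier)

text \<open>
  Infinite order lets the counts be read off from the powers of \<open>x\<close>; the orders of last occurrences
  are read off from the \<open>2 \<times> 2\<close> blocks, pair by pair.
\<close>

lemma word_rep_eq_iff:
  fixes x :: "'a::comm_semiring_1"
  assumes x: "infinite_mult_order x" and u: "u \<in> lists {1..n}" and v: "v \<in> lists {1..n}"
  shows "word_rep x n u = word_rep x n v \<longleftrightarrow> P_stal u = P_stal v"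
proof
  assume "P_stal u = P_stal v"
  then have "remdups u = remdups v" "count_list u = count_list v"
    by (auto simp: P_stal_eq_iff)
  then have "stal_block x u = stal_block x v"
    by (auto simp: stal_block_def fun_eq_iff) (metis last_pair_mat_remdups)
  then show "word_rep x n u = word_rep x n v"
    by (simp add: word_rep_def)
next
  assume eq: "word_rep x n u = word_rep x n v"
  have block: "stal_block x u (a, b) = stal_block x v (a, b)" if "1 \<le> a" "a \<le> b" "b \<le> n" for a b
    by (rule diag_block_mat_map_inj[of "block_index n" _ block_size])
      (use eq that in \<open>auto simp: word_rep_def stal_block_carrier set_block_index\<close>)
  have count: "count_list u a = count_list v a" for a
  proof (cases "a \<in> {1..n}")
    case True
    then have "stal_block x u (a, a) $$ (0, 0) = stal_block x v (a, a) $$ (0, 0)"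
      by (simp add: block)
    then have "x ^ count_list u a = x ^ count_list v a"
      by (simp add: stal_block_def)
    then show ?thesis
      using x by (auto simp: infinite_mult_order_def dest: injD)
  next
    case False
    then have "a \<notin> set u" "a \<notin> set v" using u v by auto
    then show ?thesis by (simp add: count_list_0_iff[THEN iffD2])
  qed
  have set: "set u = set v"
    using count by (metis count_list_0_iff subsetI subset_antisym)
  have last: "last (filter (\<lambda>c. c = a \<or> c = b) u) = last (filter (\<lambda>c. c = a \<or> c = b) v)"
    if "a < b" "a \<in> set u" "b \<in> set u" for a b
  proof -
    have "1 \<le> a" "a \<le> b" "b \<le> n" using that u by auto
    from block[OF this] have "last_pair_mat a b u = (last_pair_mat a b v :: 'a mat)"
      using that by (simp add: stal_block_def)
    then show ?thesis
      using that by (auto dest: last_pair_mat_eqD)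
  qed
  have "remdups u = remdups v"
  proof (rule distinct_eqI_last_pair)
    fix a b assume "a \<in> set (remdups u)" "b \<in> set (remdups u)" "a \<noteq> b"
    then have "last (filter (\<lambda>c. c = a \<or> c = b) u) = last (filter (\<lambda>c. c = a \<or> c = b) v)"
      using last[of a b] last[of b a] by (cases "a < b") (auto simp: disj_commute)
    then show "last (filter (\<lambda>c. c = a \<or> c = b) (remdups u)) =
        last (filter (\<lambda>c. c = a \<or> c = b) (remdups v))"
      by (simp add: remdups_filter_last)
  qed (simp_all add: set)
  then show "P_stal u = P_stal v"
    using count by (auto simp: P_stal_eq_iff)
qed

theorem theorem4p5:
  fixes x :: "'a::comm_semiring_1" and n :: nat
  assumes "infinite_mult_order x" and "0 < n"
  shows "\<exists>\<phi> bs.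
    \<phi> \<in> hom (stal n) (UT TYPE('a) (n\<^sup>2)) \<and>
    \<phi> \<one>\<^bsub>stal n\<^esub> = \<one>\<^bsub>UT TYPE('a) (n\<^sup>2)\<^esub> \<and>
    inj_on \<phi> (carrier (stal n)) \<and>
    (\<forall>X\<in>carrier (stal n). block_diagonal bs (\<phi> X)) \<and>
    sum_list bs = n\<^sup>2 \<and> 0 \<notin> set bs \<and>
    Max (set bs) = (if n = 1 then 1 else 2)"
proof -
  define cl where "cl u = stal_rel n `` {u}" for u
  define \<phi> where "\<phi> X = word_rep x n (SOME u. u \<in> X)" for X
  define bs where "bs = map block_size (block_index n)"
  have carr: "X \<in> carrier (stal n) \<longleftrightarrow> (\<exists>u\<in>lists {1..n}. X = cl u)" for X
    by (auto simp: stal_def quotient_def cl_def)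
  have \<phi>: "\<phi> (cl u) = word_rep x n u" if u: "u \<in> lists {1..n}" for u
  proof -
    \<comment> \<open>The chosen representative need not be \<open>u\<close>, but equivalent words have the same image.\<close>
    have cl_iff: "v \<in> cl u \<longleftrightarrow> v \<in> lists {1..n} \<and> P_stal u = P_stal v" for v
      using u by (simp add: cl_def stal_rel_def)
    then have "u \<in> cl u" using u by blast
    then have "(SOME v. v \<in> cl u) \<in> cl u" by (rule someI)
    then have "(SOME v. v \<in> cl u) \<in> lists {1..n}" "P_stal u = P_stal (SOME v. v \<in> cl u)"
      using cl_iff by blast+
    then show ?thesis
      unfolding \<phi>_def using word_rep_eq_iff[OF assms(1) u] by metis
  qed
  have "\<phi> \<in> hom (stal n) (UT TYPE('a) (n\<^sup>2))"
  proof (rule homI)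
    fix X assume "X \<in> carrier (stal n)"
    then show "\<phi> X \<in> carrier (UT TYPE('a) (n\<^sup>2))"
      unfolding carr using \<phi> word_rep_in_UT by metis
  next
    fix X Y assume "X \<in> carrier (stal n)" "Y \<in> carrier (stal n)"
    then obtain u v where uv: "u \<in> lists {1..n}" "v \<in> lists {1..n}" and "X = cl u" "Y = cl v"
      unfolding carr by blast
    then have "X \<otimes>\<^bsub>stal n\<^esub> Y = cl (u @ v)"
      by (simp only: cl_def stal_mult_class)
    moreover have "u @ v \<in> lists {1..n}" using uv by simp
    ultimately show "\<phi> (X \<otimes>\<^bsub>stal n\<^esub> Y) = \<phi> X \<otimes>\<^bsub>UT TYPE('a) (n\<^sup>2)\<^esub> \<phi> Y"
      using uv \<open>X = cl u\<close> \<open>Y = cl v\<close> by (simp only: \<phi> word_rep_append) (simp add: UT_def)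
  qed
  moreover have "\<phi> \<one>\<^bsub>stal n\<^esub> = \<one>\<^bsub>UT TYPE('a) (n\<^sup>2)\<^esub>"
    using \<phi>[of "[]"] by (simp add: stal_def UT_def cl_def word_rep_Nil)
  moreover have "inj_on \<phi> (carrier (stal n))"
  proof (rule inj_onI)
    fix X Y assume "X \<in> carrier (stal n)" "Y \<in> carrier (stal n)" and eq: "\<phi> X = \<phi> Y"
    then obtain u v where uv: "u \<in> lists {1..n}" "v \<in> lists {1..n}" and XY: "X = cl u" "Y = cl v"
      unfolding carr by blast
    then have "P_stal u = P_stal v"
      using eq word_rep_eq_iff[OF assms(1)] by (simp only: \<phi>)
    then show "X = Y" using uv by (simp add: XY cl_def stal_rel_def)
  qed
  moreover have "\<forall>X\<in>carrier (stal n). block_diagonal bs (\<phi> X)"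
    unfolding bs_def using carr \<phi> block_diagonal_word_rep by metis
  moreover have "sum_list bs = n\<^sup>2"
    by (simp add: bs_def sum_block_size)
  moreover have "0 \<notin> set bs"
    by (auto simp: bs_def block_size_def split: if_splits)
  moreover have "Max (set bs) = (if n = 1 then 1 else 2)"
  proof (rule Max_eqI)
    show "k \<le> (if n = 1 then 1 else 2)" if "k \<in> set bs" for k
      using that by (auto simp: bs_def set_block_index block_size_def split: if_splits)
    have "(1, if n = 1 then 1 else 2) \<in> set (block_index n)"
      using assms(2) by (auto simp: set_block_index)
    then have "block_size (1, if n = 1 then 1 else 2) \<in> set bs"
      unfolding bs_def set_map by (rule imageI)
    moreover have "block_size (1, if n = 1 then 1 else 2) = (if n = 1 then 1 else 2)"
      by (cases "n = 1") (simp_all add: block_size_def)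
    ultimately show "(if n = 1 then 1 else 2) \<in> set bs"
      by (simp only:)
  qed simp
  ultimately show ?thesis
    by (intro exI[of _ \<phi>] exI[of _ bs] conjI)
qed

end
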